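(* Consider the system $x(t+1)=g(x(t),u(t))$, $t\in\mathbb{N}$, with state in $\mathcal{X}\subseteq\mathbb{R}^n$ and input in $\mathcal{U}\subseteq\mathbb{R}^m$. Let $\omega:\mathbb{R}^n\to\mathbb{R}_{\ge0}$ be a measurement function, $M\in\mathbb{N}^*$, and let $V:\mathbb{R}^n\to\mathbb{R}_{\ge0}$ be a finite-step control Lyapunov function for the time step $M$, with associated admissible finite-step feedback $q:\mathcal{X}\to\mathcal{U}^M$ and decay function $\alpha\in\mathcal{K}_\infty$, $\alpha<\mathrm{id}$. For each $\xi\in\mathcal{X}$ consider the optimal control problem $$\min_{\mathbf{u}_M=(u_0,\dots,u_{M-1})}\ \sum_{i=0}^{M-1}V(x(i,\xi,\mathbf{u}_M))$$ subject to, for all $j\in\{0,\dots,M-1\}$: $x(j+1)=g(x(j),u_j)$ with $x(0)=\xi$, $u_j\in\mathcal{U}$, $g(x(j),u_j)\in\mathcal{X}$, and $V(x(M,\xi,\mathbf{u}_M))\le\alpha(V(\xi))$. Assume that an optimal solution of this problem exists for every $\xi\in\mathcal{X}$, and let $\hat q:\mathcal{X}\to\mathcal{U}^M$ assign to each $\xi$ an optimal solution $\mathbf{u}_M^*(\xi)$. Then $\hat q$ (applied over blocks of $M$ time steps, being re-evaluated at the times $t=kM$, $k\in\mathbb{N}$) is an admissible finite-step feedback which asymptotically $\omega$-stabilizes the set $\mathcal{A}:=\omega^{-1}(0)$.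
   Context: $\mathbb{N}$ are the nonnegative integers, $\mathbb{N}^*$ the positive integers. Class $\mathcal{K}$: continuous strictly increasing functions $\mathbb{R}_{\ge0}\to\mathbb{R}_{\ge0}$ vanishing at $0$; $\mathcal{K}_\infty$: unbounded class-$\mathcal{K}$ functions; $\mathcal{KL}$: continuous $\beta:\mathbb{R}_{\ge0}^2\to\mathbb{R}_{\ge0}$ with $\beta(\cdot,s)\in\mathcal{K}$ for each $s\geq 0$ and $\beta(r,\cdot)$ decreasing with $\beta(r,s)\to0$ as $s\to\infty$ for each $r\ge 0$. $\alpha<\mathrm{id}$ means $\alpha(s)<s$ for all $s>0$. Measurement function: a continuous $\omega:\mathbb{R}^n\to\mathbb{R}_{\ge0}$ with $\omega^{-1}(0)\ne\emptyset$. Standing assumptions on the system: $g:\mathcal{X}\times\mathcal{U}\to\mathbb{R}^n$ is continuous and $\mathcal{K}$-bounded on $(\mathcal X,\mathcal U)$, i.e. for measurement functions $\omega_1$ on $\mathbb{R}^n$ and $\omega_2$ on $\mathbb{R}^m$ there are $\kappa_1,\kappa_2\in\mathcal{K}$ with $\omega_1(g(\xi,\mu))\le\kappa_1(\omega_1(\xi))+\kappa_2(\omega_2(\mu))$ for all $\xi\in\mathcal{X},\mu\in\mathcal{U}$. $x(\cdot,\xi,\mathbf{u})$ denotes the solution with $x(0)=\xi$ and input sequence $\mathbf{u}$. For $\mathbf{u}_M=(u(0),\dots,u(M-1))\in\mathcal{U}^M$ put $g^1(\xi,\mathbf{u}_M)=g(\xi,u(0))$ and $g^{j+1}(\xi,\mathbf{u}_M)=g(g^j(\xi,\mathbf{u}_M),u(j))$,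 $j=1,\dots,M-1$. A map $q:\mathcal{X}\to\mathcal{U}^M$ is an admissible finite-step feedback (of length $M$, with respect to $\omega$) if for all $\xi\in\mathcal{X}$ and $j=1,\dots,M$: (1) $g^j(\xi,q(\xi))\in\mathcal{X}$; (2) there is $\kappa_j\in\mathcal{K}$ (independent of $\xi$) with $\omega(g^j(\xi,q(\xi)))\le\kappa_j(\omega(\xi))$ for all $\xi\in\mathcal X$. The closed-loop trajectory $x_q(\cdot)=x(\cdot,\xi,u_q)$ is given by $x_q(0)=\xi$ and $x_q(kM+j+1)=g^{j+1}(x_q(kM),q(x_q(kM)))$ for $k\in\mathbb{N}$, $j=0,\dots,M-1$, and $u_q$ is the resulting input sequence. An admissible finite-step feedback $q$ asymptotically $\omega$-stabilizes $\mathcal{A}=\omega^{-1}(0)$ if there is $\beta\in\mathcal{KL}$ such that $\omega(x(t,\xi,u_q))\le\beta(\omega(\xi),t)$ for all $\xi\in\mathcal{X}$ and $t\in\mathbb{N}$. A continuous $V:\mathbb{R}^n\to\mathbb{R}_{\ge0}$ with $\underline\alpha(\omega(\xi))\le V(\xi)\le\overline\alpha(\omega(\xi))$ for all $\xi\in\mathbb{R}^n$, for some $\underline\alpha,\overline\alpha\in\mathcal{K}_\infty$, is a finite-step control Lyapunov function for the time step $M$ if there exist an admissible finite-step feedback $q:\mathcal{X}\to\mathcal{U}^M$ (the associated feedback) and $\alpha\in\mathcal{K}_\infty$, $\alpha<\mathrm{id}$ (the associated decay function), such that $V(x(M,\xi,u_q))\le\alpha(V(\xi))$ for all $\xi\in\mathcal{X}$.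 *)

theory Defs
  imports "HOL-Analysis.Analysis"
begin

text \<open>Functions on \<open>\<real>\<^sub>\<ge>\<^sub>0\<close> are rendered as functions on \<^typ>\<open>real\<close>; only their values on \<open>{0..}\<close>
  are constrained.\<close>

definition class_K :: "(real \<Rightarrow> real) \<Rightarrow> bool" where
  "class_K \<alpha> \<longleftrightarrow> \<alpha> \<in> {0..} \<rightarrow> {0..} \<and> continuous_on {0..} \<alpha> \<and> strict_mono_on {0..} \<alpha> \<and> \<alpha> 0 = 0"

definition class_K_inf :: "(real \<Rightarrow> real) \<Rightarrow> bool" where
  "class_K_inf \<alpha> \<longleftrightarrow> class_K \<alpha> \<and> \<not> bdd_above (\<alpha> ` {0..})"

text \<open>Monotonicity in the second argument is non-strict, as is forced at \<open>r = 0\<close>, where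
  \<open>\<beta> 0 s = 0\<close> for all \<open>s\<close>.\<close>

definition class_KL :: "(real \<Rightarrow> real \<Rightarrow> real) \<Rightarrow> bool" where
  "class_KL \<beta> \<longleftrightarrow>
     continuous_on ({0..} \<times> {0..}) (\<lambda>(r, s). \<beta> r s) \<and>
     (\<forall>s\<ge>0. class_K (\<lambda>r. \<beta> r s)) \<and>
     (\<forall>r\<ge>0. antimono_on {0..} (\<beta> r) \<and> (\<beta> r \<longlongrightarrow> 0) at_top)"

definition below_id :: "(real \<Rightarrow> real) \<Rightarrow> bool" where
  "below_id \<alpha> \<longleftrightarrow> (\<forall>s>0. \<alpha> s < s)"

definition measurement_function :: "(real ^ 'n \<Rightarrow> real) \<Rightarrow> bool" where
  "measurement_function \<omega> \<longleftrightarrow> continuous_on UNIV \<omega> \<and> (\<forall>x. 0 \<le> \<omega> x) \<and> \<omega> -` {0} \<noteq> {}"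

definition K_bounded ::
  "(real ^ 'n \<Rightarrow> real) \<Rightarrow> (real ^ 'm \<Rightarrow> real) \<Rightarrow> (real ^ 'n) set \<Rightarrow> (real ^ 'm) set \<Rightarrow>
   (real ^ 'n \<Rightarrow> real ^ 'm \<Rightarrow> real ^ 'n) \<Rightarrow> bool" where
  "K_bounded \<omega>1 \<omega>2 X U g \<longleftrightarrow>
     (\<exists>\<kappa>1 \<kappa>2. class_K \<kappa>1 \<and> class_K \<kappa>2 \<and>
        (\<forall>\<xi>\<in>X. \<forall>\<mu>\<in>U. \<omega>1 (g \<xi> \<mu>) \<le> \<kappa>1 (\<omega>1 \<xi>) + \<kappa>2 (\<omega>2 \<mu>)))"

text \<open>\<open>solution g \<xi> u t\<close> is \<open>x(t, \<xi>, u)\<close>. A finite input sequence \<open>us\<close> is passed as \<open>nth us\<close>, in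
  which case only times \<open>t \<le> length us\<close> are meaningful.\<close>

primrec solution ::
  "(real ^ 'n \<Rightarrow> real ^ 'm \<Rightarrow> real ^ 'n) \<Rightarrow> real ^ 'n \<Rightarrow> (nat \<Rightarrow> real ^ 'm) \<Rightarrow> nat \<Rightarrow> real ^ 'n" where
  "solution g \<xi> u 0 = \<xi>"
| "solution g \<xi> u (Suc t) = g (solution g \<xi> u t) (u t)"

definition tuples :: "'a set \<Rightarrow> nat \<Rightarrow> 'a list set" where
  "tuples U M = {us. length us = M \<and> set us \<subseteq> U}"

text \<open>\<open>iter g j \<xi> us\<close> is \<open>g\<^sup>j(\<xi>, us)\<close>, extended by \<open>g\<^sup>0(\<xi>, us) = \<xi>\<close>.\<close>

primrec iter ::
  "(real ^ 'n \<Rightarrow> real ^ 'm \<Rightarrow> real ^ 'n) \<Rightarrow> nat \<Rightarrow> real ^ 'n \<Rightarrow> (real ^ 'm) list \<Rightarrow> real ^ 'n" where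
  "iter g 0 \<xi> us = \<xi>"
| "iter g (Suc j) \<xi> us = g (iter g j \<xi> us) (us ! j)"

definition admissible_feedback ::
  "(real ^ 'n \<Rightarrow> real ^ 'm \<Rightarrow> real ^ 'n) \<Rightarrow> (real ^ 'n) set \<Rightarrow> (real ^ 'm) set \<Rightarrow>
   (real ^ 'n \<Rightarrow> real) \<Rightarrow> nat \<Rightarrow> (real ^ 'n \<Rightarrow> (real ^ 'm) list) \<Rightarrow> bool" where
  "admissible_feedback g X U \<omega> M q \<longleftrightarrow>
     q \<in> X \<rightarrow> tuples U M \<and>
     (\<forall>\<xi>\<in>X. \<forall>j\<in>{1..M}. iter g j \<xi> (q \<xi>) \<in> X) \<and>
     (\<forall>j\<in>{1..M}. \<exists>\<kappa>. class_K \<kappa> \<and> (\<forall>\<xi>\<in>X. \<omega> (iter g j \<xi> (q \<xi>)) \<le> \<kappa> (\<omega> \<xi>)))"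

text \<open>The trajectory \<open>x\<^sub>q\<close>; a time \<open>t\<close> is decomposed as \<open>t = k M + j\<close> with \<open>k = t div M\<close> and
  \<open>j = t mod M\<close>.\<close>

function closed_loop ::
  "(real ^ 'n \<Rightarrow> real ^ 'm \<Rightarrow> real ^ 'n) \<Rightarrow> nat \<Rightarrow> (real ^ 'n \<Rightarrow> (real ^ 'm) list) \<Rightarrow>
   real ^ 'n \<Rightarrow> nat \<Rightarrow> real ^ 'n" where
  "closed_loop g M q \<xi> 0 = \<xi>"
| "closed_loop g M q \<xi> (Suc t) =
     iter g (Suc (t mod M)) (closed_loop g M q \<xi> (t div M * M)) (q (closed_loop g M q \<xi> (t div M * M)))"
  by pat_completeness auto
termination
  by (relation "Wellfounded.measure (\<lambda>(g, M, q, \<xi>, t). t)") (auto simp: less_Suc_eq_le)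

definition closed_loop_input ::
  "(real ^ 'n \<Rightarrow> real ^ 'm \<Rightarrow> real ^ 'n) \<Rightarrow> nat \<Rightarrow> (real ^ 'n \<Rightarrow> (real ^ 'm) list) \<Rightarrow>
   real ^ 'n \<Rightarrow> nat \<Rightarrow> real ^ 'm" where
  "closed_loop_input g M q \<xi> t = q (closed_loop g M q \<xi> (t div M * M)) ! (t mod M)"

lemma closed_loop_block:
  assumes "j < M"
  shows "closed_loop g M q \<xi> (k * M + j + 1) =
    iter g (j + 1) (closed_loop g M q \<xi> (k * M)) (q (closed_loop g M q \<xi> (k * M)))"
  using assms by simp

lemma closed_loop_eq_solution:
  assumes "M > 0"
  shows "closed_loop g M q \<xi> t = solution g \<xi> (closed_loop_input g M q \<xi>) t"
proof (induction t)
  case 0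
  show ?case by simp
next
  case (Suc t)
  let ?z = "closed_loop g M q \<xi> (t div M * M)"
  have "closed_loop g M q \<xi> t = iter g (t mod M) ?z (q ?z)"
  proof (cases "t mod M")
    case 0
    then have "t div M * M = t" by (metis add.right_neutral div_mult_mod_eq)
    with 0 show ?thesis by simp
  next
    case (Suc i)
    have "i < M" using Suc assms by (metis Suc_lessD mod_less_divisor)
    moreover have "t = t div M * M + i + 1" using Suc by (metis Suc_eq_plus1 add.assoc div_mult_mod_eq)
    ultimately show ?thesis using closed_loop_block[of i M g q \<xi> "t div M"] Suc by (metis Suc_eq_plus1)
  qed
  with Suc.IH show ?case by (simp add: closed_loop_input_def)
qed

definition asymptotically_stabilizes ::
  "(real ^ 'n \<Rightarrow> real ^ 'm \<Rightarrow> real ^ 'n) \<Rightarrow> (real ^ 'n) set \<Rightarrow>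
   (real ^ 'n \<Rightarrow> real) \<Rightarrow> nat \<Rightarrow> (real ^ 'n \<Rightarrow> (real ^ 'm) list) \<Rightarrow> bool" where
  "asymptotically_stabilizes g X \<omega> M q \<longleftrightarrow>
     (\<exists>\<beta>. class_KL \<beta> \<and>
        (\<forall>\<xi>\<in>X. \<forall>t::nat. \<omega> (solution g \<xi> (closed_loop_input g M q \<xi>) t) \<le> \<beta> (\<omega> \<xi>) (real t)))"

text \<open>\<open>V\<close> is a finite-step control Lyapunov function for the time step \<open>M\<close>, with associated feedback
  \<open>q\<close> and associated decay function \<open>\<alpha>\<close>.\<close>

definition finite_step_CLF ::
  "(real ^ 'n \<Rightarrow> real ^ 'm \<Rightarrow> real ^ 'n) \<Rightarrow> (real ^ 'n) set \<Rightarrow> (real ^ 'm) set \<Rightarrow>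
   (real ^ 'n \<Rightarrow> real) \<Rightarrow> nat \<Rightarrow> (real ^ 'n \<Rightarrow> real) \<Rightarrow>
   (real ^ 'n \<Rightarrow> (real ^ 'm) list) \<Rightarrow> (real \<Rightarrow> real) \<Rightarrow> bool" where
  "finite_step_CLF g X U \<omega> M V q \<alpha> \<longleftrightarrow>
     continuous_on UNIV V \<and> (\<forall>\<xi>. 0 \<le> V \<xi>) \<and>
     (\<exists>\<alpha>1 \<alpha>2. class_K_inf \<alpha>1 \<and> class_K_inf \<alpha>2 \<and> (\<forall>\<xi>. \<alpha>1 (\<omega> \<xi>) \<le> V \<xi> \<and> V \<xi> \<le> \<alpha>2 (\<omega> \<xi>))) \<and>
     admissible_feedback g X U \<omega> M q \<and>
     class_K_inf \<alpha> \<and> below_id \<alpha> \<and>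
     (\<forall>\<xi>\<in>X. V (solution g \<xi> (closed_loop_input g M q \<xi>) M) \<le> \<alpha> (V \<xi>))"

definition ocp_cost ::
  "(real ^ 'n \<Rightarrow> real ^ 'm \<Rightarrow> real ^ 'n) \<Rightarrow> nat \<Rightarrow> (real ^ 'n \<Rightarrow> real) \<Rightarrow>
   real ^ 'n \<Rightarrow> (real ^ 'm) list \<Rightarrow> real" where
  "ocp_cost g M V \<xi> us = (\<Sum>i<M. V (solution g \<xi> (nth us) i))"

definition ocp_feasible ::
  "(real ^ 'n \<Rightarrow> real ^ 'm \<Rightarrow> real ^ 'n) \<Rightarrow> (real ^ 'n) set \<Rightarrow> (real ^ 'm) set \<Rightarrow> nat \<Rightarrow>
   (real ^ 'n \<Rightarrow> real) \<Rightarrow> (real \<Rightarrow> real) \<Rightarrow> real ^ 'n \<Rightarrow> (real ^ 'm) list \<Rightarrow> bool" where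
  "ocp_feasible g X U M V \<alpha> \<xi> us \<longleftrightarrow>
     us \<in> tuples U M \<and>
     (\<forall>j<M. g (solution g \<xi> (nth us) j) (us ! j) \<in> X) \<and>
     V (solution g \<xi> (nth us) M) \<le> \<alpha> (V \<xi>)"

definition ocp_optimal ::
  "(real ^ 'n \<Rightarrow> real ^ 'm \<Rightarrow> real ^ 'n) \<Rightarrow> (real ^ 'n) set \<Rightarrow> (real ^ 'm) set \<Rightarrow> nat \<Rightarrow>
   (real ^ 'n \<Rightarrow> real) \<Rightarrow> (real \<Rightarrow> real) \<Rightarrow> real ^ 'n \<Rightarrow> (real ^ 'm) list \<Rightarrow> bool" where
  "ocp_optimal g X U M V \<alpha> \<xi> us \<longleftrightarrow>
     is_arg_min (ocp_cost g M V \<xi>) (ocp_feasible g X U M V \<alpha> \<xi>) us"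

end

theory Submission
  imports Defs
begin

text \<open>The feedback \<open>q\<close> of the Lyapunov function is feasible for the optimal control problem, so the
  optimal cost at \<open>\<xi>\<close> is at most the cost of \<open>q\<close>, which is bounded by a class-\<open>\<K>\<close> function of
  \<open>\<omega> \<xi>\<close>. As all summands of the cost are nonnegative, this bounds \<open>V\<close>, hence \<open>\<omega>\<close>, along a whole
  block of the optimal trajectory. The terminal constraint gives \<open>V(x(kM)) \<le> \<alpha>\<^sup>k(V \<xi>)\<close>, and
  the iterates \<open>\<alpha>\<^sup>k\<close>, interpolated linearly in \<open>k\<close>, form a class-\<open>\<K>\<L>\<close> function.\<close>

section \<open>Class-K functions: monotonicity, closure properties and inverses\<close>

lemma class_K_nonneg: "class_K f \<Longrightarrow> 0 \<le> x \<Longrightarrow> 0 \<le> f x"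
  by (auto simp: class_K_def Pi_iff)

lemma class_K_zero: "class_K f \<Longrightarrow> f 0 = 0"
  by (simp add: class_K_def)

lemma class_K_less: "class_K f \<Longrightarrow> 0 \<le> x \<Longrightarrow> x < y \<Longrightarrow> f x < f y"
  by (auto simp: class_K_def strict_mono_on_def)

lemma class_K_le: "class_K f \<Longrightarrow> 0 \<le> x \<Longrightarrow> x \<le> y \<Longrightarrow> f x \<le> f y"
  using class_K_less[of f x y] by (cases "x = y") auto

lemma class_K_continuous: "class_K f \<Longrightarrow> continuous_on {0..} f"
  by (simp add: class_K_def)

text \<open>Strict growth from the value 0 at 0 already forces nonnegative values, so three
  obligations remain.\<close>

lemma class_KI:
  assumes "continuous_on {0..} f" "\<And>x y. 0 \<le> x \<Longrightarrow> x < y \<Longrightarrow> f x < f y" "f 0 = 0"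
  shows "class_K f"
proof -
  have "0 \<le> f x" if "0 \<le> x" for x
    using that assms(2)[of 0 x] assms(3) by (cases "x = 0") auto
  then show ?thesis
    using assms by (auto simp: class_K_def strict_mono_on_def)
qed

lemma class_K_id: "class_K (\<lambda>x. x)"
  by (rule class_KI) auto

lemma class_K_compose:
  assumes "class_K f" "class_K h"
  shows "class_K (\<lambda>x. f (h x))"
proof (rule class_KI)
  show "continuous_on {0..} (\<lambda>x. f (h x))"
    by (rule continuous_on_compose2[OF class_K_continuous[OF assms(1)] class_K_continuous[OF assms(2)]])
      (auto simp: class_K_nonneg assms)
qed (auto simp: class_K_less class_K_nonneg class_K_zero assms)

lemma class_K_add:
  assumes "class_K f" "class_K h"
  shows "class_K (\<lambda>x. f x + h x)"
  by (rule class_KI)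
    (auto intro!: continuous_intros add_strict_mono simp: class_K_less class_K_zero class_K_continuous assms)

text \<open>The separate summand \<open>f\<close> keeps the total strictly increasing when
  \<open>I\<close> is empty, where the sum alone is constantly 0.\<close>

lemma class_K_add_sum:
  assumes "finite I" "class_K f" "\<And>i. i \<in> I \<Longrightarrow> class_K (h i)"
  shows "class_K (\<lambda>x. f x + (\<Sum>i\<in>I. h i x))"
  using assms(1,3)
proof (induction I)
  case empty
  then show ?case using assms(2) by simp
next
  case (insert i I)
  have "class_K (\<lambda>x. h i x + (f x + (\<Sum>i\<in>I. h i x)))"
    using insert by (intro class_K_add[of "h i"]) auto
  then show ?case
    using insert by (simp add: algebra_simps)
qed

lemma class_K_funpow: "class_K f \<Longrightarrow> class_K (f ^^ k)"
proof (induction k)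
  case 0
  then show ?case using class_K_id by (simp add: id_def)
next
  case (Suc k)
  then show ?case using class_K_compose[of f "f ^^ k"] by (simp add: comp_def)
qed

text \<open>Unboundedness and the intermediate value theorem make \<open>f\<close> map
  \<open>{0..}\<close> onto itself, and a continuous injection of an interval is a homeomorphism
  onto its image. The left inverse serves to turn a bound on \<open>V\<close> into one on
  \<omega>.\<close>

lemma class_K_inf_inverse:
  assumes "class_K_inf f"
  obtains h where "class_K h" "\<And>x. 0 \<le> x \<Longrightarrow> h (f x) = x"
proof -
  have f: "class_K f" and unb: "\<not> bdd_above (f ` {0..})"
    using assms by (auto simp: class_K_inf_def)
  have inj: "inj_on f {0..}"
    using f by (auto simp: class_K_def intro: strict_mono_on_imp_inj_on)
  have img: "f ` {0..} = {0..}"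
  proof (intro equalityI subsetI)
    fix y :: real assume y: "y \<in> {0..}"
    obtain x where x: "0 \<le> x" "y < f x"
      using unb by (auto simp: bdd_above_def not_le)
    have "\<exists>z\<ge>0. z \<le> x \<and> f z = y"
      using x y class_K_zero[OF f]
      by (intro IVT' continuous_on_subset[OF class_K_continuous[OF f]]) auto
    then show "y \<in> f ` {0..}" by auto
  qed (auto simp: class_K_nonneg[OF f])
  obtain h where h: "homeomorphism {0..} {0..} f h"
    using homeomorphism_into_1d[OF _ class_K_continuous[OF f] img inj]
    by (auto simp: convex_imp_path_connected)
  then have hf: "\<And>x. 0 \<le> x \<Longrightarrow> h (f x) = x" and fh: "\<And>y. 0 \<le> y \<Longrightarrow> f (h y) = y"
    and cont: "continuous_on {0..} h" and him: "\<And>y. 0 \<le> y \<Longrightarrow> 0 \<le> h y"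
    by (auto simp: homeomorphism_def)
  have "class_K h"
  proof (rule class_KI[OF cont])
    show "h 0 = 0" using hf[of 0] class_K_zero[OF f] by simp
  next
    \<comment> \<open>By contraposition: \<open>h y \<le> h x\<close> would give
      \<open>y \<le> x\<close> after applying the monotone \<open>f\<close>.\<close>
    fix x y :: real assume "0 \<le> x" "x < y"
    then show "h x < h y"
      using class_K_le[OF f, of "h y" "h x"] fh[of x] fh[of y] him[of y] by (auto simp: not_le[symmetric])
  qed
  with hf show thesis by (rule that[rotated])
qed

section \<open>Iteration of a class-K function below the identity\<close>

lemma below_id_le:
  assumes "class_K f" "below_id f" "0 \<le> x"
  shows "f x \<le> x"
  using assms by (cases "x = 0") (auto simp: below_id_def class_K_zero less_imp_le)

text \<open>The orbit is decreasing and bounded below by 0, hence convergent. By continuity its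
  limit is a fixed point of \<open>f\<close>, and \<open>below_id\<close> excludes every positive
  fixed point.\<close>

lemma funpow_below_id_tendsto:
  assumes "class_K f" "below_id f" "0 \<le> x"
  shows "(\<lambda>k. (f ^^ k) x) \<longlonglongrightarrow> 0"
proof -
  let ?a = "\<lambda>k. (f ^^ k) x"
  have nn: "0 \<le> ?a k" for k
    using class_K_nonneg[OF class_K_funpow[OF assms(1)] assms(3)] .
  have "decseq ?a"
    by (rule decseq_SucI) (simp add: below_id_le assms nn)
  then obtain L where L: "?a \<longlonglongrightarrow> L"
    using decseq_convergent[of ?a 0] nn by blast
  have "0 \<le> L"
    using LIMSEQ_le_const[OF L] nn by blast
  have "(\<lambda>k. f (?a k)) \<longlonglongrightarrow> f L"
    using class_K_continuous[OF assms(1)] L \<open>0 \<le> L\<close> nn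
    by (intro continuous_on_tendsto_compose[of "{0..}" f]) auto
  moreover have "(\<lambda>k. f (?a k)) \<longlonglongrightarrow> L"
    using LIMSEQ_Suc[OF L] by simp
  ultimately have "f L = L" by (rule LIMSEQ_unique)
  with \<open>0 \<le> L\<close> assms(2) have "L = 0"
    by (metis below_id_def less_irrefl order_le_less)
  with L show ?thesis by simp
qed

section \<open>Class-KL functions: interpolated iterates and changes of variable\<close>

definition clamp01 :: "real \<Rightarrow> real" where
  "clamp01 x = min 1 (max 0 x)"

text \<open>A telescoping sum started at \<open>r\<close>: the decrement from the
  \<open>k\<close>-th to the next iterate is switched on linearly while \<open>s\<close> runs
  through the interval from \<open>k\<close> to \<open>k + 1\<close>.\<close>

definition interpolant :: "(real \<Rightarrow> real) \<Rightarrow> nat \<Rightarrow> real \<Rightarrow> real \<Rightarrow> real" where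
  "interpolant f N r s = r - (\<Sum>k<N. ((f ^^ k) r - (f ^^ Suc k) r) * clamp01 (s - real k))"

text \<open>The piecewise linear interpolation in \<open>s\<close> of \<open>k \<mapsto> f\<^sup>k(r)\<close>. Any truncation index \<open>N \<ge> s\<close>
  gives the same value, which makes joint continuity a local statement about finite sums.\<close>

definition iterate_interpolation :: "(real \<Rightarrow> real) \<Rightarrow> real \<Rightarrow> real \<Rightarrow> real" where
  "iterate_interpolation f r s = interpolant f (nat \<lceil>s\<rceil>) r s"

text \<open>The added terms have index at least \<open>N\<close>, hence at least \<open>s\<close>,
  so their clamps are still 0.\<close>

lemma interpolant_add:
  assumes "s \<le> real N"
  shows "interpolant f (N + m) r s = interpolant f N r s"
proof (induction m)
  case (Suc m)
  have "clamp01 (s - real (N + m)) = 0"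
    using assms by (simp add: clamp01_def)
  with Suc show ?case by (simp add: interpolant_def)
qed simp

lemma iterate_interpolation_eq:
  assumes "s \<le> real N"
  shows "iterate_interpolation f r s = interpolant f N r s"
proof -
  have le: "nat \<lceil>s\<rceil> \<le> N" using assms by linarith
  have "s \<le> real (nat \<lceil>s\<rceil>)" by linarith
  from interpolant_add[OF this, of f "N - nat \<lceil>s\<rceil>" r] le show ?thesis
    by (simp add: iterate_interpolation_def)
qed

text \<open>Once \<open>s\<close> has passed \<open>N\<close>, all clamps with index below
  \<open>N\<close> equal 1 and the sum telescopes.\<close>

lemma interpolant_telescope:
  assumes "real N \<le> s"
  shows "interpolant f N r s = (f ^^ N) r"
  using assms
proof (induction N)
  case (Suc N)
  then have "clamp01 (s - real N) = 1" by (simp add: clamp01_def)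
  with Suc show ?case by (simp add: interpolant_def)
qed (simp add: interpolant_def)

lemma iterate_interpolation_nat: "iterate_interpolation f r (real k) = (f ^^ k) r"
  by (simp add: iterate_interpolation_eq[of _ k] interpolant_telescope)

text \<open>The first \<open>k\<close> decrements are fully switched on and the next one to the
  fraction \<open>frac s\<close>. For fixed \<open>s\<close> this exhibits the function of
  \<open>r\<close> as a convex combination of two class-K iterates.\<close>

lemma iterate_interpolation_convex:
  assumes "0 \<le> s"
  defines "k \<equiv> nat \<lfloor>s\<rfloor>"
  shows "iterate_interpolation f r s = (1 - frac s) * (f ^^ k) r + frac s * (f ^^ Suc k) r"
proof -
  have k: "real k = s - frac s" using assms by (simp add: frac_def)
  have "frac s < 1" "0 \<le> frac s" by (auto simp: frac_lt_1)
  then have "clamp01 (s - real k) = frac s" "real k \<le> s" "s \<le> real (Suc k)"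
    using k by (auto simp: clamp01_def)
  moreover have "interpolant f (Suc k) r s =
      interpolant f k r s - ((f ^^ k) r - (f ^^ Suc k) r) * clamp01 (s - real k)"
    by (simp add: interpolant_def)
  ultimately show ?thesis
    by (simp add: iterate_interpolation_eq[of _ "Suc k"] interpolant_telescope algebra_simps)
qed

lemma continuous_on_iterate_interpolation:
  assumes "class_K f"
  shows "continuous_on ({0..} \<times> {0..}) (\<lambda>(r, s). iterate_interpolation f r s)"
proof -
  have "continuous (at (r, s) within {0..} \<times> {0..}) (\<lambda>(r, s). iterate_interpolation f r s)"
    if rs: "0 \<le> r" "0 \<le> s" for r s :: real
  proof -
    obtain N where N: "s < real N" using reals_Archimedean2 by blast
    \<comment> \<open>The index \<open>N\<close> chosen for this \<open>s\<close> works on the whole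
      strip \<open>?T\<close>, where the function is thus one fixed finite sum of continuous
      terms.\<close>
    let ?T = "UNIV \<times> {..<real N} :: (real \<times> real) set"
    have pow: "continuous_on (({0..} \<times> {0..}) \<inter> ?T) (\<lambda>p. (f ^^ k) (fst p))" for k
      by (rule continuous_on_compose2[OF class_K_continuous[OF class_K_funpow[OF assms]]])
        (auto intro: continuous_on_fst continuous_on_snd)
    have "continuous_on (({0..} \<times> {0..}) \<inter> ?T) (\<lambda>p. interpolant f N (fst p) (snd p))"
      unfolding interpolant_def clamp01_def
      by (intro continuous_intros pow)
    then have "continuous_on (({0..} \<times> {0..}) \<inter> ?T) (\<lambda>(r, s). iterate_interpolation f r s)"
      by (rule continuous_on_eq) (auto simp: iterate_interpolation_eq[of _ N])
    then have "continuous (at (r, s) within ({0..} \<times> {0..}) \<inter> ?T) (\<lambda>(r, s). iterate_interpolation f r s)"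
      using rs N by (auto simp: continuous_on_eq_continuous_within)
    \<comment> \<open>The strip is an open neighbourhood of the point, so restricting to it leaves
      the limit filter unchanged.\<close>
    moreover have "at (r, s) within ({0..} \<times> {0..}) \<inter> ?T = at (r, s) within {0..} \<times> {0..}"
      using N by (intro at_within_nhd[of _ ?T]) (auto intro: open_Times)
    ultimately show ?thesis by (metis (no_types, lifting) continuous_def continuous_within)
  qed
  then show ?thesis
    by (auto simp: continuous_on_eq_continuous_within)
qed

lemma class_KL_iterate_interpolation:
  assumes "class_K f" "below_id f"
  shows "class_KL (iterate_interpolation f)"
  unfolding class_KL_def
proof (intro conjI allI impI)
  show cont: "continuous_on ({0..} \<times> {0..}) (\<lambda>(r, s). iterate_interpolation f r s)"
    by (rule continuous_on_iterate_interpolation[OF assms(1)])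
  note pow = class_K_funpow[OF assms(1)]
  have K: "class_K (\<lambda>r. iterate_interpolation f r s)" if "0 \<le> s" for s
  proof (rule class_KI)
    let ?k = "nat \<lfloor>s\<rfloor>"
    show "continuous_on {0..} (\<lambda>r. iterate_interpolation f r s)"
      unfolding iterate_interpolation_convex[OF that]
      by (intro continuous_intros class_K_continuous pow)
    show "iterate_interpolation f 0 s = 0"
      unfolding iterate_interpolation_convex[OF that] by (simp only: class_K_zero[OF pow] mult_zero_right add_0)
    fix x y :: real assume xy: "0 \<le> x" "x < y"
    \<comment> \<open>Strictness comes from this term, whose weight is positive; the weight
      \<open>frac s\<close> of the other one vanishes at integers.\<close>
    have "(1 - frac s) * (f ^^ ?k) x < (1 - frac s) * (f ^^ ?k) y"
      using class_K_less[OF pow xy] by (simp add: frac_lt_1)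
    moreover have "frac s * (f ^^ Suc ?k) x \<le> frac s * (f ^^ Suc ?k) y"
      by (rule mult_left_mono[OF less_imp_le[OF class_K_less[OF pow xy]]]) simp
    ultimately show "iterate_interpolation f x s < iterate_interpolation f y s"
      unfolding iterate_interpolation_convex[OF that] by linarith
  qed
  then show "class_K (\<lambda>r. iterate_interpolation f r s)" if "0 \<le> s" for s using that .
  fix r :: real assume r: "0 \<le> r"
  show anti: "antimono_on {0..} (iterate_interpolation f r)"
  proof (rule monotone_onI)
    fix s t :: real assume "s \<in> {0..}" "t \<in> {0..}" "s \<le> t"
    \<comment> \<open>A common truncation index for both times allows a termwise comparison: the
      decrements are nonnegative because \<open>f\<close> is below the identity, and the clamps grow
      with time.\<close>
    obtain N where N: "t < real N" using reals_Archimedean2 by blast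
    have "(\<Sum>k<N. ((f ^^ k) r - (f ^^ Suc k) r) * clamp01 (s - real k))
        \<le> (\<Sum>k<N. ((f ^^ k) r - (f ^^ Suc k) r) * clamp01 (t - real k))"
      using \<open>s \<le> t\<close> below_id_le[OF assms class_K_nonneg[OF pow r]]
      by (intro sum_mono mult_left_mono) (auto simp: clamp01_def)
    then show "iterate_interpolation f r t \<le> iterate_interpolation f r s"
      using N \<open>s \<le> t\<close> by (simp add: iterate_interpolation_eq[of _ N] interpolant_def)
  qed
  show "(iterate_interpolation f r \<longlongrightarrow> 0) at_top"
  proof (rule tendstoI)
    fix e :: real assume "0 < e"
    then obtain k where k: "(f ^^ k) r < e"
      using order_tendstoD(2)[OF funpow_below_id_tendsto[OF assms r]]
      by (auto simp: eventually_sequentially)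
    show "\<forall>\<^sub>F s in at_top. dist (iterate_interpolation f r s) 0 < e"
      using eventually_ge_at_top[of "real k"]
    proof eventually_elim
      case (elim s)
      \<comment> \<open>Monotonicity in time carries smallness at the integer \<open>k\<close> over
        to all later real times.\<close>
      then have "iterate_interpolation f r s \<le> (f ^^ k) r"
        using monotone_onD[OF anti, of "real k" s] by (simp add: iterate_interpolation_nat)
      moreover have "0 \<le> iterate_interpolation f r s"
        using elim by (intro class_K_nonneg[OF K] r) auto
      ultimately show ?case using k by simp
    qed
  qed
qed

text \<open>Allows rescaling of the output, of the initial value and of time. The time change \<tau>
  may be constant on intervals, since strictness is demanded only in \<open>r\<close>; its
  divergence preserves the limit 0.\<close>

lemma class_KL_compose:
  assumes B: "class_KL \<beta>" and K: "class_K \<gamma>" "class_K \<delta>"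
    and cont: "continuous_on {0..} \<tau>" and mono: "mono_on {0..} \<tau>"
    and nonneg: "\<And>s. 0 \<le> s \<Longrightarrow> 0 \<le> \<tau> s" and lim: "filterlim \<tau> at_top at_top"
  shows "class_KL (\<lambda>r s. \<gamma> (\<beta> (\<delta> r) (\<tau> s)))"
  unfolding class_KL_def
proof (intro conjI allI impI)
  have BK: "class_K (\<lambda>r. \<beta> r s)" if "0 \<le> s" for s
    using B that by (simp add: class_KL_def)
  have Bnn: "0 \<le> \<beta> r s" if "0 \<le> r" "0 \<le> s" for r s
    using class_K_nonneg[OF BK] that by blast
  have Bcont: "continuous_on ({0..} \<times> {0..}) (\<lambda>p. \<beta> (fst p) (snd p))"
    using B by (simp add: class_KL_def case_prod_unfold)
  have c1: "continuous_on ({0..} \<times> {0..}) (\<lambda>p::real\<times>real. \<delta> (fst p))"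
    by (rule continuous_on_compose2[OF class_K_continuous[OF K(2)]]) (auto intro: continuous_on_fst continuous_on_snd)
  have c2: "continuous_on ({0..} \<times> {0..}) (\<lambda>p::real\<times>real. \<tau> (snd p))"
    by (rule continuous_on_compose2[OF cont]) (auto intro: continuous_on_fst continuous_on_snd)
  have "continuous_on ({0..} \<times> {0..}) (\<lambda>p. \<beta> (\<delta> (fst p)) (\<tau> (snd p)))"
    using continuous_on_compose2[OF Bcont continuous_on_Pair[OF c1 c2]] class_K_nonneg[OF K(2)] nonneg
    by (simp add: image_subset_iff)
  then have "continuous_on ({0..} \<times> {0..}) (\<lambda>p. \<gamma> (\<beta> (\<delta> (fst p)) (\<tau> (snd p))))"
    by (rule continuous_on_compose2[OF class_K_continuous[OF K(1)]])
      (auto intro!: Bnn nonneg class_K_nonneg[OF K(2)])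
  then show "continuous_on ({0..} \<times> {0..}) (\<lambda>(r, s). \<gamma> (\<beta> (\<delta> r) (\<tau> s)))"
    by (simp add: case_prod_unfold)
  show "class_K (\<lambda>r. \<gamma> (\<beta> (\<delta> r) (\<tau> s)))" if "0 \<le> s" for s
    using class_K_compose[OF K(1) class_K_compose[OF BK K(2)]] nonneg that by blast
  fix r :: real assume "0 \<le> r"
  then have r: "0 \<le> \<delta> r" by (rule class_K_nonneg[OF K(2)])
  then have anti: "antimono_on {0..} (\<beta> (\<delta> r))" and Blim: "(\<beta> (\<delta> r) \<longlongrightarrow> 0) at_top"
    using B by (auto simp: class_KL_def)
  show "antimono_on {0..} (\<lambda>s. \<gamma> (\<beta> (\<delta> r) (\<tau> s)))"
  proof (rule monotone_onI)
    fix s t :: real assume st: "s \<in> {0..}" "t \<in> {0..}" "s \<le> t"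
    then have "\<tau> s \<le> \<tau> t" using mono by (auto simp: mono_on_def)
    then have "\<beta> (\<delta> r) (\<tau> t) \<le> \<beta> (\<delta> r) (\<tau> s)"
      using monotone_onD[OF anti] st nonneg by auto
    then show "\<gamma> (\<beta> (\<delta> r) (\<tau> t)) \<le> \<gamma> (\<beta> (\<delta> r) (\<tau> s))"
      using st by (intro class_K_le[OF K(1)] Bnn r nonneg) auto
  qed
  have "((\<lambda>s. \<gamma> (\<beta> (\<delta> r) (\<tau> s))) \<longlongrightarrow> \<gamma> 0) at_top"
  proof (rule continuous_on_tendsto_compose[OF class_K_continuous[OF K(1)]])
    show "((\<lambda>s. \<beta> (\<delta> r) (\<tau> s)) \<longlongrightarrow> 0) at_top"
      by (rule filterlim_compose[OF Blim lim])
    show "\<forall>\<^sub>F s in at_top. \<beta> (\<delta> r) (\<tau> s) \<in> {0..}"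
      using eventually_ge_at_top[of 0] by eventually_elim (auto intro: Bnn r nonneg)
  qed simp
  then show "((\<lambda>s. \<gamma> (\<beta> (\<delta> r) (\<tau> s))) \<longlongrightarrow> 0) at_top"
    by (simp add: class_K_zero[OF K(1)])
qed

section \<open>Closed-loop trajectories and stability from decay over blocks\<close>

lemma solution_nth_eq_iter: "solution g \<xi> (nth us) j = iter g j \<xi> us"
  by (induction j) auto

text \<open>Both ends of a block are covered: \<open>j = 0\<close> is its initial state, and
  \<open>j = M\<close> identifies its final state with the start of the next block.\<close>

lemma closed_loop_decompose:
  assumes "j \<le> M"
  shows "closed_loop g M q \<xi> (k * M + j) =
    iter g j (closed_loop g M q \<xi> (k * M)) (q (closed_loop g M q \<xi> (k * M)))"
proof (cases j)
  case (Suc i)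
  then show ?thesis using closed_loop_block[of i M g q \<xi> k] assms by (simp del: closed_loop.simps)
qed simp

text \<open>The decay of \<open>V\<close> controls only the times that are multiples of
  \<open>M\<close>; the bound \<kappa>, uniform in \<open>j\<close>, extends this control to the
  times in between.\<close>

lemma stabilizes_of_block_decay:
  assumes "M > 0"
    and inv: "\<And>\<xi>. \<xi> \<in> X \<Longrightarrow> iter g M \<xi> (q \<xi>) \<in> X"
    and nonneg: "\<And>\<xi>. 0 \<le> \<omega> \<xi>" "\<And>\<xi>. 0 \<le> V \<xi>"
    and K: "class_K \<alpha>" "below_id \<alpha>" "class_K \<kappa>" "class_K \<sigma>" "class_K \<alpha>2"
    and lower: "\<And>\<xi>. \<omega> \<xi> \<le> \<sigma> (V \<xi>)" and upper: "\<And>\<xi>. V \<xi> \<le> \<alpha>2 (\<omega> \<xi>)"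
    and block: "\<And>\<xi> j. \<xi> \<in> X \<Longrightarrow> j < M \<Longrightarrow> \<omega> (iter g j \<xi> (q \<xi>)) \<le> \<kappa> (\<omega> \<xi>)"
    and decay: "\<And>\<xi>. \<xi> \<in> X \<Longrightarrow> V (iter g M \<xi> (q \<xi>)) \<le> \<alpha> (V \<xi>)"
  shows "asymptotically_stabilizes g X \<omega> M q"
proof -
  \<comment> \<open>The delay by one block makes \<open>\<tau> (k M + j) \<le> k\<close> for all \<open>j < M\<close>.\<close>
  define \<tau> where "\<tau> s = max 0 (s / real M - 1)" for s
  \<comment> \<open>Read from the inside out: \<open>\<alpha>2\<close> passes from \<omega> to
    \<open>V\<close>, the interpolated iterates give the decay at block starts, \<sigma> returns to
    \<omega>, and \<kappa> accounts for the motion inside a block.\<close>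
  define \<beta> where "\<beta> r s = \<kappa> (\<sigma> (iterate_interpolation \<alpha> (\<alpha>2 r) (\<tau> s)))" for r s
  note pow = class_K_funpow[OF K(1)]
  note KL = class_KL_iterate_interpolation[OF K(1,2)]
  have "class_KL \<beta>"
    unfolding \<beta>_def
  proof (rule class_KL_compose[OF KL class_K_compose[OF K(3,4)] K(5)])
    show "continuous_on {0..} \<tau>" unfolding \<tau>_def using assms(1) by (intro continuous_intros) auto
    show "mono_on {0..} \<tau>" unfolding \<tau>_def
      by (auto intro!: mono_onI max.mono divide_right_mono)
    show "0 \<le> \<tau> s" for s by (simp add: \<tau>_def)
    show "filterlim \<tau> at_top at_top"
      unfolding filterlim_at_top
    proof
      fix Z
      show "\<forall>\<^sub>F s in at_top. Z \<le> \<tau> s"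
        using eventually_ge_at_top[of "(Z + 1) * real M"]
      proof eventually_elim
        case (elim s)
        then have "Z + 1 \<le> s / real M" using assms(1) by (simp add: field_simps)
        then show ?case by (simp add: \<tau>_def)
      qed
    qed
  qed
  moreover have "\<omega> (solution g \<xi> (closed_loop_input g M q \<xi>) t) \<le> \<beta> (\<omega> \<xi>) (real t)"
    if "\<xi> \<in> X" for \<xi> t
  proof -
    let ?x = "closed_loop g M q \<xi>"
    have step: "?x (Suc k * M) = iter g M (?x (k * M)) (q (?x (k * M)))" for k
      using closed_loop_decompose[of M M g q \<xi> k] by (simp add: add.commute)
    \<comment> \<open>Invariance and decay are proved together because the decay estimate is
      available only at states in \<open>X\<close>.\<close>
    have xk: "?x (k * M) \<in> X \<and> V (?x (k * M)) \<le> (\<alpha> ^^ k) (V \<xi>)" for k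
    proof (induction k)
      case 0
      then show ?case using that by simp
    next
      case (Suc k)
      then have "V (?x (Suc k * M)) \<le> \<alpha> (V (?x (k * M)))" unfolding step by (blast intro: decay)
      also have "\<dots> \<le> \<alpha> ((\<alpha> ^^ k) (V \<xi>))"
        using Suc nonneg by (intro class_K_le[OF K(1)]) auto
      finally show ?case using inv Suc unfolding step by simp
    qed
    define k j where "k = t div M" and "j = t mod M"
    have t: "t = k * M + j" and j: "j < M" using assms(1) by (auto simp: k_def j_def)
    have "V (?x (k * M)) \<le> (\<alpha> ^^ k) (\<alpha>2 (\<omega> \<xi>))"
      using xk[of k] class_K_le[OF pow, of "V \<xi>" "\<alpha>2 (\<omega> \<xi>)" k] upper nonneg by fastforce
    also have "\<dots> = iterate_interpolation \<alpha> (\<alpha>2 (\<omega> \<xi>)) (real k)"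
      by (simp add: iterate_interpolation_nat)
    also have "\<dots> \<le> iterate_interpolation \<alpha> (\<alpha>2 (\<omega> \<xi>)) (\<tau> (real t))"
    proof -
      \<comment> \<open>Moving back to the time \<open>\<tau> (real t)\<close> can only enlarge the
        bound; the \<open>max 0\<close> in \<tau> keeps this time in \<open>{0..}\<close> during the
        first block.\<close>
      have "real t \<le> (real k + 1) * real M" using t j by (simp add: algebra_simps)
      then have "\<tau> (real t) \<le> real k" using assms(1) by (simp add: \<tau>_def field_simps)
      moreover have "antimono_on {0..} (iterate_interpolation \<alpha> (\<alpha>2 (\<omega> \<xi>)))"
        using KL class_K_nonneg[OF K(5) nonneg(1)] by (auto simp: class_KL_def)
      ultimately show ?thesis
        using monotone_onD[of "{0..}" _ _ _ "\<tau> (real t)" "real k"] by (fastforce simp: \<tau>_def)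
    qed
    finally have V: "V (?x (k * M)) \<le> iterate_interpolation \<alpha> (\<alpha>2 (\<omega> \<xi>)) (\<tau> (real t))" .
    have "\<omega> (?x t) \<le> \<kappa> (\<omega> (?x (k * M)))"
      unfolding t using closed_loop_decompose[of j M g q \<xi> k] block xk j by (metis less_imp_le)
    also have "\<dots> \<le> \<kappa> (\<sigma> (V (?x (k * M))))"
      by (intro class_K_le[OF K(3)] nonneg lower)
    also have "\<dots> \<le> \<beta> (\<omega> \<xi>) (real t)"
      unfolding \<beta>_def by (intro class_K_le[OF class_K_compose[OF K(3,4)]] nonneg V)
    finally show ?thesis by (simp add: closed_loop_eq_solution[OF assms(1)])
  qed
  ultimately show ?thesis unfolding asymptotically_stabilizes_def by blast
qed

section \<open>The feedback given by the optimal control problem\<close>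

theorem proposition13:
  fixes X :: "(real ^ 'n) set" and U :: "(real ^ 'm) set"
    and g :: "real ^ 'n \<Rightarrow> real ^ 'm \<Rightarrow> real ^ 'n"
    and \<omega> \<omega>1 :: "real ^ 'n \<Rightarrow> real" and \<omega>2 :: "real ^ 'm \<Rightarrow> real"
    and V :: "real ^ 'n \<Rightarrow> real" and \<alpha> :: "real \<Rightarrow> real" and M :: nat
    and q qhat :: "real ^ 'n \<Rightarrow> (real ^ 'm) list"
  assumes "continuous_on (X \<times> U) (\<lambda>(\<xi>, \<mu>). g \<xi> \<mu>)"
    and "measurement_function \<omega>1" and "measurement_function \<omega>2"
    and "K_bounded \<omega>1 \<omega>2 X U g"
    and "measurement_function \<omega>"
    and "M > 0"
    and "finite_step_CLF g X U \<omega> M V q \<alpha>"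
    and "\<forall>\<xi>\<in>X. \<exists>us. ocp_optimal g X U M V \<alpha> \<xi> us"
    and "\<forall>\<xi>\<in>X. ocp_optimal g X U M V \<alpha> \<xi> (qhat \<xi>)"
  shows "admissible_feedback g X U \<omega> M qhat \<and> asymptotically_stabilizes g X \<omega> M qhat"
proof -
  have wnn: "0 \<le> \<omega> \<xi>" for \<xi>
    using assms(5) by (simp add: measurement_function_def)
  obtain \<alpha>1 \<alpha>2 where K: "class_K_inf \<alpha>1" "class_K \<alpha>2" "class_K \<alpha>" "below_id \<alpha>"
    and lo: "\<And>\<xi>. \<alpha>1 (\<omega> \<xi>) \<le> V \<xi>" and up: "\<And>\<xi>. V \<xi> \<le> \<alpha>2 (\<omega> \<xi>)"
    and Vnn: "\<And>\<xi>. 0 \<le> V \<xi>" and q: "admissible_feedback g X U \<omega> M q"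
    and dec: "\<And>\<xi>. \<xi> \<in> X \<Longrightarrow> V (solution g \<xi> (closed_loop_input g M q \<xi>) M) \<le> \<alpha> (V \<xi>)"
    using assms(7) unfolding finite_step_CLF_def class_K_inf_def[of \<alpha>] by (auto simp: class_K_inf_def)
  obtain \<sigma> where \<sigma>: "class_K \<sigma>" "\<And>x. 0 \<le> x \<Longrightarrow> \<sigma> (\<alpha>1 x) = x"
    using class_K_inf_inverse[OF K(1)] by blast
  have lower: "\<omega> \<xi> \<le> \<sigma> (V \<xi>)" for \<xi>
    using class_K_le[OF \<sigma>(1) _ lo[of \<xi>]] \<sigma>(2)[OF wnn] class_K_nonneg[OF _ wnn] K(1)
    by (metis class_K_inf_def)
  obtain \<kappa> where \<kappa>: "\<And>j. j \<in> {1..M} \<Longrightarrow> class_K (\<kappa> j)"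
    "\<And>j \<xi>. j \<in> {1..M} \<Longrightarrow> \<xi> \<in> X \<Longrightarrow> \<omega> (iter g j \<xi> (q \<xi>)) \<le> \<kappa> j (\<omega> \<xi>)"
    using q unfolding admissible_feedback_def by metis
  \<comment> \<open>Bounds the cost of \<open>q\<close>. The summand at time 0 is
    \<open>V \<xi>\<close> itself, bounded by \<open>\<alpha>2\<close>; the bounds
    \<open>\<kappa> i\<close> exist only from \<open>i = 1\<close> on. The leading
    \<open>\<alpha>2\<close> keeps \<open>C\<close> in class K also for
    \<open>M = 1\<close>.\<close>
  define C where "C r = \<alpha>2 r + (\<Sum>i\<in>{1..<M}. \<alpha>2 (\<kappa> i r))" for r
  have C: "class_K C"
    unfolding C_def by (intro class_K_add_sum class_K_compose[OF K(2)] K(2) \<kappa>(1)) auto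
  have le_C: "\<alpha>2 r \<le> C r" if "0 \<le> r" for r
    unfolding C_def using that
    by (auto intro!: sum_nonneg class_K_nonneg[OF class_K_compose[OF K(2) \<kappa>(1)]])
  have feasible: "ocp_feasible g X U M V \<alpha> \<xi> (q \<xi>)" if "\<xi> \<in> X" for \<xi>
    unfolding ocp_feasible_def solution_nth_eq_iter
  proof (intro conjI allI impI)
    show "q \<xi> \<in> tuples U M" using q that by (auto simp: admissible_feedback_def)
    show "g (iter g j \<xi> (q \<xi>)) (q \<xi> ! j) \<in> X" if "j < M" for j
    proof -
      have "iter g (Suc j) \<xi> (q \<xi>) \<in> X"
        using q \<open>\<xi> \<in> X\<close> that unfolding admissible_feedback_def by (simp del: iter.simps)
      then show ?thesis by simp
    qed
    \<comment> \<open>Block 0 of the closed loop is the finite run of \<open>q \<xi>\<close>, so the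
      Lyapunov decrease becomes the terminal constraint.\<close>
    show "V (iter g M \<xi> (q \<xi>)) \<le> \<alpha> (V \<xi>)"
      using dec[OF that] closed_loop_decompose[of M M g q \<xi> 0]
      by (simp add: closed_loop_eq_solution[OF assms(6), symmetric])
  qed
  have cost: "ocp_cost g M V \<xi> (q \<xi>) \<le> C (\<omega> \<xi>)" if "\<xi> \<in> X" for \<xi>
  proof -
    have "{..<M} = insert 0 {1..<M}" using assms(6) by auto
    then have "ocp_cost g M V \<xi> (q \<xi>) = V \<xi> + (\<Sum>i\<in>{1..<M}. V (iter g i \<xi> (q \<xi>)))"
      by (simp add: ocp_cost_def solution_nth_eq_iter)
    also have "\<dots> \<le> C (\<omega> \<xi>)"
      unfolding C_def
    proof (intro add_mono sum_mono up)
      fix i assume "i \<in> {1..<M}"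
      then show "V (iter g i \<xi> (q \<xi>)) \<le> \<alpha>2 (\<kappa> i (\<omega> \<xi>))"
        using class_K_le[OF K(2) wnn \<kappa>(2)[of i, OF _ that]] up[of "iter g i \<xi> (q \<xi>)"] by fastforce
    qed
    finally show ?thesis .
  qed
  have hat: "ocp_feasible g X U M V \<alpha> \<xi> (qhat \<xi>)" "ocp_cost g M V \<xi> (qhat \<xi>) \<le> C (\<omega> \<xi>)"
    if "\<xi> \<in> X" for \<xi>
  proof -
    have opt: "is_arg_min (ocp_cost g M V \<xi>) (ocp_feasible g X U M V \<alpha> \<xi>) (qhat \<xi>)"
      using assms(9) that by (simp add: ocp_optimal_def)
    then show "ocp_feasible g X U M V \<alpha> \<xi> (qhat \<xi>)" by (simp add: is_arg_min_def)
    have "ocp_cost g M V \<xi> (qhat \<xi>) \<le> ocp_cost g M V \<xi> (q \<xi>)"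
      using opt feasible[OF that] by (simp add: is_arg_min_linorder)
    with cost[OF that] show "ocp_cost g M V \<xi> (qhat \<xi>) \<le> C (\<omega> \<xi>)" by simp
  qed
  \<comment> \<open>The state constraint with index \<open>i\<close> concerns the state at time
    \<open>i + 1\<close>, so \<open>i < M\<close> covers exactly the times from 1 to
    \<open>M\<close>.\<close>
  have inv: "iter g j \<xi> (qhat \<xi>) \<in> X" if "\<xi> \<in> X" "j \<in> {1..M}" for \<xi> j
    using hat(1)[OF that(1)] that(2)
    by (cases j) (auto simp: ocp_feasible_def solution_nth_eq_iter)
  have decay: "V (iter g M \<xi> (qhat \<xi>)) \<le> \<alpha> (V \<xi>)" if "\<xi> \<in> X" for \<xi>
    using hat(1)[OF that] by (simp add: ocp_feasible_def solution_nth_eq_iter)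
  have VC: "V (iter g j \<xi> (qhat \<xi>)) \<le> C (\<omega> \<xi>)" if "\<xi> \<in> X" "j \<le> M" for \<xi> j
  proof (cases "j = M")
    \<comment> \<open>The final state does not enter the cost, which sums over times below
      \<open>M\<close>. Here the terminal constraint, \<alpha> below the identity and
      \<open>le_C\<close> give the bound.\<close>
    case True
    have "V (iter g M \<xi> (qhat \<xi>)) \<le> V \<xi>"
      using decay[OF that(1)] below_id_le[OF K(3,4) Vnn] by (rule order_trans)
    also have "\<dots> \<le> C (\<omega> \<xi>)" using up le_C[OF wnn] by (rule order_trans)
    finally show ?thesis using True by simp
  next
    case False
    then have "V (iter g j \<xi> (qhat \<xi>)) \<le> ocp_cost g M V \<xi> (qhat \<xi>)"
      unfolding ocp_cost_def solution_nth_eq_iter using that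
      by (intro member_le_sum) (auto simp: Vnn)
    then show ?thesis using hat(2)[OF that(1)] by simp
  qed
  \<comment> \<open>This one function serves for every \<open>j\<close> in admissibility and also as
    the bound inside blocks in the stability argument.\<close>
  have \<sigma>C: "class_K (\<lambda>r. \<sigma> (C r))" by (rule class_K_compose[OF \<sigma>(1) C])
  have block: "\<omega> (iter g j \<xi> (qhat \<xi>)) \<le> \<sigma> (C (\<omega> \<xi>))" if "\<xi> \<in> X" "j \<le> M" for \<xi> j
    using lower class_K_le[OF \<sigma>(1) Vnn VC[OF that]] by (rule order_trans)
  have "admissible_feedback g X U \<omega> M qhat"
    unfolding admissible_feedback_def
  proof (intro conjI ballI Pi_I)
    show "qhat \<xi> \<in> tuples U M" if "\<xi> \<in> X" for \<xi>
      using hat(1)[OF that] by (simp add: ocp_feasible_def)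
    show "iter g j \<xi> (qhat \<xi>) \<in> X" if "\<xi> \<in> X" "j \<in> {1..M}" for \<xi> j
      using inv that .
    show "\<exists>\<kappa>. class_K \<kappa> \<and> (\<forall>\<xi>\<in>X. \<omega> (iter g j \<xi> (qhat \<xi>)) \<le> \<kappa> (\<omega> \<xi>))" if "j \<in> {1..M}" for j
      using \<sigma>C block that by (intro exI[of _ "\<lambda>r. \<sigma> (C r)"]) auto
  qed
  moreover have "asymptotically_stabilizes g X \<omega> M qhat"
    by (rule stabilizes_of_block_decay[OF assms(6) _ wnn Vnn K(3,4) \<sigma>C \<sigma>(1) K(2) lower up])
      (use inv block decay assms(6) in auto)
  ultimately show ?thesis ..
qed

end
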